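(* Let $f=h+\overline{g}$ be a harmonic function in the unit disk $\mathbb{D}$, where $h$ and $g$ are analytic in $\mathbb{D}$, such that its Jacobian satisfies $J_f>0$ in $\mathbb{D}$. If $(h-g)(\mathbb{D})$ and $f(\mathbb{D})$ are nonempty simply connected domains, then the following statements are equivalent: (1) $f$ is a 1-1 mapping and $f(\mathbb{D})$ is a union of two non-disjoint domains convex in the direction of the real axis. (2) $h-g$ is a 1-1 analytic mapping and $(h-g)(\mathbb{D})$ is a union of two non-disjoint domains convex in the direction of the real axis.
   Context: $\mathbb{D}=\{z\in\mathbb{C}:|z|<1\}$. A function $f:\mathbb{D}\to\mathbb{C}$ is harmonic if its real and imaginary parts satisfy the Laplace equation; equivalently $f=h+\overline{g}$ with $h,g$ analytic in $\mathbb{D}$. Its Jacobian is $J_f(z)=|h'(z)|^2-|g'(z)|^2$. A domain is a nonempty open connected subset of $\mathbb{C}$; it is convex in the direction of the real axis if its intersection with every horizontal line $\{z\in\mathbb{C}:\Im z=a\}$, $a\in\mathbb{R}$, is connected or empty. "1-1" means injective. *)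

theory Defs
  imports "HOL-Analysis.Analysis"
begin

definition planar_domain :: "complex set \<Rightarrow> bool" where
  "planar_domain S \<longleftrightarrow> S \<noteq> {} \<and> open S \<and> connected S"

(* The empty set is connected, so "connected or empty" is just connectedness. *)
definition convex_in_real_direction :: "complex set \<Rightarrow> bool" where
  "convex_in_real_direction S \<longleftrightarrow> (\<forall>a::real. connected (S \<inter> {z. Im z = a}))"

definition union_of_two_real_convex_domains :: "complex set \<Rightarrow> bool" where
  "union_of_two_real_convex_domains S \<longleftrightarrow>
     (\<exists>A B. planar_domain A \<and> convex_in_real_direction A \<and>
            planar_domain B \<and> convex_in_real_direction B \<and>
            A \<inter> B \<noteq> {} \<and> S = A \<union> B)"

(* Twice continuously differentiable solutions of the Laplace equation:
   ux, uy are the partial derivatives of u with respect to Re z and Im z, and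
   uxx, uxy, uyx, uyy those of ux and uy. *)
definition real_harmonic_on :: "(complex \<Rightarrow> real) \<Rightarrow> complex set \<Rightarrow> bool" where
  "real_harmonic_on u S \<longleftrightarrow>
     (\<exists>ux uy uxx uxy uyx uyy.
        continuous_on S uxx \<and> continuous_on S uxy \<and>
        continuous_on S uyx \<and> continuous_on S uyy \<and>
        (\<forall>z\<in>S.
           (u has_derivative (\<lambda>v. ux z * Re v + uy z * Im v)) (at z) \<and>
           (ux has_derivative (\<lambda>v. uxx z * Re v + uxy z * Im v)) (at z) \<and>
           (uy has_derivative (\<lambda>v. uyx z * Re v + uyy z * Im v)) (at z) \<and>
           uxx z + uyy z = 0))"

definition complex_harmonic_on :: "(complex \<Rightarrow> complex) \<Rightarrow> complex set \<Rightarrow> bool" where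
  "complex_harmonic_on f S \<longleftrightarrow>
     real_harmonic_on (\<lambda>z. Re (f z)) S \<and> real_harmonic_on (\<lambda>z. Im (f z)) S"

(* The Jacobian of f = h + cnj g, expressed through its analytic parts h and g. *)
definition harmonic_jacobian ::
    "(complex \<Rightarrow> complex) \<Rightarrow> (complex \<Rightarrow> complex) \<Rightarrow> complex \<Rightarrow> real" where
  "harmonic_jacobian h g z = (cmod (deriv h z))\<^sup>2 - (cmod (deriv g z))\<^sup>2"

end

theory Submission
  imports Defs "HOL-Complex_Analysis.Riemann_Mapping"
begin

text \<open>
  Since \<open>f = (h - g) + 2 Re g\<close>, the functions \<open>f\<close> and \<open>h - g\<close> have the same imaginary part, and
  \<open>J\<^sub>f > 0\<close> makes both locally injective.  If one of them, \<open>p\<close>, is injective, then the other one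
  is \<open>G \<circ> p\<close> with \<open>G\<close> a locally injective map that preserves heights.  On a horizontal interval
  such a map is injective, so \<open>G\<close> is injective on each of the two domains \<open>A\<close>, \<open>B\<close> convex in the
  real direction whose union is the image of \<open>p\<close>, and it maps them to domains of the same kind.
  A simply connected planar domain is unicoherent, so \<open>G(A) \<inter> G(B)\<close> is connected; the two inverse
  branches over it agree on the nonempty set \<open>G(A \<inter> B)\<close>, which is both open and closed in it.
  Hence they agree everywhere and \<open>G\<close> is injective on \<open>A \<union> B\<close>.
\<close>

section \<open>Local injectivity on real intervals\<close>

text \<open>Neighbourhoods are cut down to \<open>S\<close>, so that the notion serves both for open
  planar domains and for compact real intervals.\<close>

definition locally_inj_on :: "('a::topological_space \<Rightarrow> 'b) \<Rightarrow> 'a set \<Rightarrow> bool" where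
  "locally_inj_on f S \<longleftrightarrow> (\<forall>x\<in>S. \<exists>U. open U \<and> x \<in> U \<and> inj_on f (U \<inter> S))"

lemma locally_inj_on_subset:
  "locally_inj_on f S \<Longrightarrow> T \<subseteq> S \<Longrightarrow> locally_inj_on f T"
  unfolding locally_inj_on_def by (meson inf_mono inj_on_subset order_refl subsetD)

text \<open>Rolle's argument without derivatives: equal endpoint values would force an extremum at
  an interior point, but a continuous function that is injective near that point is strictly
  monotone there.\<close>

lemma locally_inj_on_Icc_endpoints:
  fixes r :: "real \<Rightarrow> real"
  assumes "x < y" and cont: "continuous_on {x..y} r" and loc: "locally_inj_on r {x..y}"
  shows "r x \<noteq> r y"
proof
  assume eq: "r x = r y"
  obtain M where M: "M \<in> {x..y}" "\<And>t. t \<in> {x..y} \<Longrightarrow> r t \<le> r M"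
    using continuous_attains_sup[OF _ _ cont] \<open>x < y\<close> by fastforce
  obtain m where m: "m \<in> {x..y}" "\<And>t. t \<in> {x..y} \<Longrightarrow> r m \<le> r t"
    using continuous_attains_inf[OF _ _ cont] \<open>x < y\<close> by fastforce
  have "\<exists>c\<in>{x<..<y}. (\<forall>t\<in>{x..y}. r t \<le> r c) \<or> (\<forall>t\<in>{x..y}. r c \<le> r t)"
  proof (cases "M \<in> {x<..<y} \<or> m \<in> {x<..<y}")
    case True
    then show ?thesis using M m by blast
  next
    case False
    \<comment> \<open>Maximum and minimum are both attained at endpoints, where the values agree. So
      \<open>r\<close> is constant and the midpoint serves as the interior extremum.\<close>
    then have "r M = r x" "r m = r x"
      using M(1) m(1) eq by (auto simp: less_le)
    then have "\<forall>t\<in>{x..y}. r t = r x"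
      using M(2) m(2) by (metis order_antisym)
    moreover have "(x + y) / 2 \<in> {x<..<y}" "(x + y) / 2 \<in> {x..y}"
      using \<open>x < y\<close> by auto
    ultimately show ?thesis
      by (metis order_refl)
  qed
  then obtain c where c: "x < c" "c < y"
    and ext: "(\<forall>t\<in>{x..y}. r t \<le> r c) \<or> (\<forall>t\<in>{x..y}. r c \<le> r t)"
    by auto
  obtain U where U: "open U" "c \<in> U" "inj_on r (U \<inter> {x..y})"
    using loc c unfolding locally_inj_on_def by (meson atLeastAtMost_iff less_imp_le)
  have "open (U \<inter> {x<..<y})" "c \<in> U \<inter> {x<..<y}"
    using U c by auto
  then obtain d where d: "d > 0" "cball c d \<subseteq> U \<inter> {x<..<y}"
    by (meson open_contains_cball)
  then have "{c - d..c + d} \<subseteq> U \<inter> {x<..<y}"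
    by (simp add: cball_eq_atLeastAtMost)
  then have sub: "{c - d..c + d} \<subseteq> U \<inter> {x..y}"
    by (rule order_trans) auto
  have "(r (c - d) < r c \<and> r c < r (c + d)) \<or> (r (c + d) < r c \<and> r c < r (c - d))"
  proof (rule continuous_inj_imp_mono[where f = r])
    show "continuous_on {c - d..c + d} r"
      using cont sub by (meson continuous_on_subset le_inf_iff)
    show "inj_on r {c - d..c + d}"
      using U(3) sub inj_on_subset by blast
  qed (use d in auto)
  moreover have "c - d \<in> {x..y}" "c + d \<in> {x..y}"
    using sub d by auto
  ultimately show False
    using ext by (metis leD)
qed

section \<open>Height-preserving maps on domains convex in the real direction\<close>

text \<open>Two points with the same image have the same height, so the horizontal segment between
  them stays in \<open>A\<close>. Along it only the real part of \<open>G\<close> varies, which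
  reduces the claim to a real function on an interval.\<close>

lemma inj_on_of_convex_in_real_direction:
  assumes conv: "convex_in_real_direction A"
    and cont: "continuous_on A G" and loc: "locally_inj_on G A"
    and height: "\<And>w. w \<in> A \<Longrightarrow> Im (G w) = Im w"
  shows "inj_on G A"
proof -
  have neq: "G v \<noteq> G w" if vw: "v \<in> A" "w \<in> A" "Im v = Im w" "Re v < Re w" for v w
  proof
    assume eq: "G v = G w"
    let ?l = "\<lambda>t. Complex t (Im v)"
    let ?r = "\<lambda>t. Re (G (?l t))"
    have line: "?l t \<in> A" if t: "t \<in> {Re v..Re w}" for t
    proof -
      \<comment> \<open>A connected set of reals contains every value between two of its members, so
        projecting the slice by \<open>Re\<close> recovers the whole segment.\<close>
      have "connected (Re ` (A \<inter> {z. Im z = Im v}))"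
        using conv unfolding convex_in_real_direction_def
        by (intro connected_continuous_image continuous_intros) auto
      then have "{Re v..Re w} \<subseteq> Re ` (A \<inter> {z. Im z = Im v})"
        by (rule connected_contains_Icc) (use vw in auto)
      then obtain z where "z \<in> A" "Im z = Im v" "Re z = t"
        using t by auto
      then show ?thesis
        by (metis complex.collapse)
    qed
    have contl: "continuous_on T ?l" for T
      by (simp add: Complex_eq continuous_intros)
    have "?r (Re v) \<noteq> ?r (Re w)"
    proof (rule locally_inj_on_Icc_endpoints[where r = ?r])
      show "continuous_on {Re v..Re w} ?r"
        by (intro continuous_intros continuous_on_compose2[OF cont contl]) (use line in auto)
      show "locally_inj_on ?r {Re v..Re w}"
        unfolding locally_inj_on_def
      proof
        fix t assume t: "t \<in> {Re v..Re w}"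
        obtain U where U: "open U" "?l t \<in> U" "inj_on G (U \<inter> A)"
          using loc line[OF t] unfolding locally_inj_on_def by blast
        have "inj_on ?r (?l -` U \<inter> {Re v..Re w})"
        proof (rule inj_onI)
          fix s u assume su: "s \<in> ?l -` U \<inter> {Re v..Re w}" "u \<in> ?l -` U \<inter> {Re v..Re w}"
            and "?r s = ?r u"
          then have "G (?l s) = G (?l u)"
            using height line by (simp add: complex_eq_iff)
          moreover have "?l s \<in> U \<inter> A" "?l u \<in> U \<inter> A"
            using su line by auto
          ultimately have "?l s = ?l u"
            using U(3) by (meson inj_onD)
          then show "s = u" by simp
        qed
        moreover have "open (?l -` U)"
          using U(1) contl by (rule open_vimage)
        ultimately show "\<exists>V. open V \<and> t \<in> V \<and> inj_on ?r (V \<inter> {Re v..Re w})"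
          using U(2) by (intro exI[of _ "?l -` U"]) auto
      qed
    qed (use vw in auto)
    moreover have "?l (Re v) = v" "?l (Re w) = w"
      using vw by (auto simp: complex_eq_iff)
    ultimately show False
      using eq by simp
  qed
  show ?thesis
  proof (rule inj_onI)
    fix v w assume vw: "v \<in> A" "w \<in> A" "G v = G w"
    then have "Im v = Im w"
      using height by metis
    then show "v = w"
      using neq[of v w] neq[of w v] vw by (metis complex_eqI linorder_neqE)
  qed
qed

lemma convex_in_real_direction_image:
  assumes "convex_in_real_direction A" "continuous_on A G"
    and height: "\<And>w. w \<in> A \<Longrightarrow> Im (G w) = Im w"
  shows "convex_in_real_direction (G ` A)"
  unfolding convex_in_real_direction_def
proof
  fix a
  have "G ` A \<inter> {z. Im z = a} = G ` (A \<inter> {z. Im z = a})"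
    using height by auto
  then show "connected (G ` A \<inter> {z. Im z = a})"
    using assms unfolding convex_in_real_direction_def
    by (metis connected_continuous_image continuous_on_subset inf_le1)
qed

section \<open>Unicoherence and gluing of two injective pieces\<close>

text \<open>By the Riemann mapping theorem a nonempty simply connected open set is homeomorphic to
  the disc, hence to the plane. The unicoherence of the plane is pulled back along this
  homeomorphism.\<close>

lemma connected_Int_of_simply_connected_Un:
  fixes S T :: "complex set"
  assumes "open S" "open T" "connected S" "connected T" "simply_connected (S \<union> T)"
  shows "connected (S \<inter> T)"
proof (cases "S \<union> T = {}")
  case False
  then have "S \<union> T homeomorphic (UNIV :: complex set)"
    using assms simply_connected_eq_homeomorphic_to_disc[of "S \<union> T"]
      homeomorphic_ball01_UNIV homeomorphic_trans by blast
  then obtain k l :: "complex \<Rightarrow> complex" where kl: "homeomorphism (S \<union> T) UNIV k l"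
    by (auto simp: homeomorphic_def)
  have lk: "l (k x) = x" if "x \<in> S \<union> T" for x
    using kl that by (simp add: homeomorphism_def)
  have contk: "continuous_on (S \<union> T) k" and contl: "continuous_on UNIV l"
    and kim: "k ` (S \<union> T) = UNIV"
    using kl by (auto simp: homeomorphism_def)
  have injk: "inj_on k (S \<union> T)"
    by (metis inj_on_inverseI lk)
  have "connected (k ` S \<inter> k ` T)"
  proof (rule open_unicoherent_UNIV)
    show "open (k ` S)" "open (k ` T)"
      using contk injk assms
      by (meson continuous_on_subset inj_on_subset invariance_of_domain Un_upper1 Un_upper2)+
    show "connected (k ` S)" "connected (k ` T)"
      using contk assms by (meson connected_continuous_image continuous_on_subset Un_upper1 Un_upper2)+
    show "k ` S \<union> k ` T = UNIV"
      using kim by blast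
  qed
  then have "connected (l ` (k ` S \<inter> k ` T))"
    using contl connected_continuous_image continuous_on_subset by blast
  moreover have "l ` (k ` S \<inter> k ` T) = S \<inter> T"
    using injk lk by (auto simp: inj_on_image_Int[symmetric] image_iff inj_on_def)
  ultimately show ?thesis by simp
qed auto

lemma inj_on_Un_of_simply_connected_image:
  fixes G :: "complex \<Rightarrow> complex"
  assumes AB: "open A" "open B" "connected A" "connected B" "A \<inter> B \<noteq> {}"
    and cont: "continuous_on (A \<union> B) G" and injA: "inj_on G A" and injB: "inj_on G B"
    and sc: "simply_connected (G ` (A \<union> B))"
  shows "inj_on G (A \<union> B)"
proof -
  have contA: "continuous_on A G" and contB: "continuous_on B G"
    using cont continuous_on_subset by blast+
  obtain a where a: "homeomorphism A (G ` A) G a"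
    using invariance_of_domain_homeomorphism[OF AB(1) contA _ injA] by auto
  obtain b where b: "homeomorphism B (G ` B) G b"
    using invariance_of_domain_homeomorphism[OF AB(2) contB _ injB] by auto
  have openG: "open (G ` A)" "open (G ` B)" "open (G ` (A \<inter> B))"
    using invariance_of_domain AB contA contB injA injB
    by (meson continuous_on_subset inf_le1 inj_on_subset open_Int)+
  let ?I = "G ` A \<inter> G ` B"
  have conI: "connected ?I"
    using connected_Int_of_simply_connected_Un openG AB contA contB sc
    by (metis connected_continuous_image image_Un)
  have eqI: "G ` (A \<inter> B) = {p \<in> ?I. a p - b p = 0}"
  proof (intro equalityI subsetI)
    fix p assume "p \<in> G ` (A \<inter> B)"
    then show "p \<in> {p \<in> ?I. a p - b p = 0}"
      using homeomorphism_apply1[OF a] homeomorphism_apply1[OF b] by auto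
  next
    fix p assume "p \<in> {p \<in> ?I. a p - b p = 0}"
    then have p: "p \<in> G ` A" "p \<in> G ` B" "a p = b p" by auto
    then have "a p \<in> A \<inter> B" "G (a p) = p"
      using homeomorphism_image2[OF a] homeomorphism_image2[OF b] homeomorphism_apply2[OF a]
      by (metis IntI imageI)+
    then show "p \<in> G ` (A \<inter> B)" by force
  qed
  have "continuous_on ?I (\<lambda>p. a p - b p)"
    using homeomorphism_cont2[OF a] homeomorphism_cont2[OF b]
    by (intro continuous_on_diff) (auto intro: continuous_on_subset)
  then have "closedin (top_of_set ?I) (G ` (A \<inter> B))"
    unfolding eqI by (rule continuous_closedin_preimage_constant)
  moreover have "openin (top_of_set ?I) (G ` (A \<inter> B))"
    using openG(3) unfolding openin_open by (intro exI[of _ "G ` (A \<inter> B)"]) auto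
  ultimately have eq: "G ` (A \<inter> B) = ?I"
    using conI AB(5) unfolding connected_clopen by blast
  \<comment> \<open>The common value has a preimage \<open>u\<close> in both pieces; injectivity on
    \<open>A\<close> gives \<open>v = u\<close>, and injectivity on \<open>B\<close> gives
    \<open>w = u\<close>.\<close>
  have cross: "v = w" if "v \<in> A" "w \<in> B" "G v = G w" for v w
  proof -
    have "G v \<in> G ` (A \<inter> B)"
      unfolding eq using that by (metis IntI imageI)
    then obtain u where "u \<in> A" "u \<in> B" "G u = G v" by auto
    then show ?thesis
      using that injA injB by (metis inj_onD)
  qed
  then show ?thesis
    using injA injB unfolding inj_on_def by (metis Un_iff)
qed

text \<open>The images of the two pieces form the new decomposition, and each piece is handled on
  its own. Only injectivity across the pieces calls on \<open>sc\<close>.\<close>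

lemma union_of_two_real_convex_domains_image:
  assumes union: "union_of_two_real_convex_domains S"
    and cont: "continuous_on S G" and loc: "locally_inj_on G S"
    and height: "\<And>w. w \<in> S \<Longrightarrow> Im (G w) = Im w"
    and sc: "simply_connected (G ` S)"
  shows "inj_on G S \<and> union_of_two_real_convex_domains (G ` S)"
proof -
  obtain A B where A: "planar_domain A" "convex_in_real_direction A"
    and B: "planar_domain B" "convex_in_real_direction B"
    and AB: "A \<inter> B \<noteq> {}" "S = A \<union> B"
    using union unfolding union_of_two_real_convex_domains_def by blast
  have *: "inj_on G C \<and> planar_domain (G ` C) \<and> convex_in_real_direction (G ` C)"
    if C: "planar_domain C" "convex_in_real_direction C" "C \<subseteq> S" for C
  proof -
    have contC: "continuous_on C G"
      using cont C(3) continuous_on_subset by blast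
    have heightC: "\<And>w. w \<in> C \<Longrightarrow> Im (G w) = Im w"
      using height C(3) by blast
    have injC: "inj_on G C"
      using inj_on_of_convex_in_real_direction[OF C(2) contC _ heightC]
        locally_inj_on_subset[OF loc C(3)] by blast
    then have "planar_domain (G ` C)"
      using C(1) contC unfolding planar_domain_def
      by (simp add: connected_continuous_image invariance_of_domain)
    then show ?thesis
      using injC convex_in_real_direction_image[OF C(2) contC heightC] by blast
  qed
  have GA: "inj_on G A" "planar_domain (G ` A)" "convex_in_real_direction (G ` A)"
    and GB: "inj_on G B" "planar_domain (G ` B)" "convex_in_real_direction (G ` B)"
    using *[of A] *[of B] A B AB(2) by auto
  have "inj_on G S"
    using inj_on_Un_of_simply_connected_image[of A B G] A(1) B(1) AB cont GA(1) GB(1) sc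
    unfolding planar_domain_def by blast
  moreover have "G ` A \<inter> G ` B \<noteq> {}" "G ` S = G ` A \<union> G ` B"
    using AB by auto
  ultimately show ?thesis
    using GA GB unfolding union_of_two_real_convex_domains_def by blast
qed

section \<open>Passing between two functions with the same imaginary part\<close>

text \<open>Applied with the two functions in either order, this gives both directions of the
  equivalence. The height-preserving map is \<open>q\<close> composed with the inverse of
  \<open>p\<close>.\<close>

lemma transfer_between_equal_heights:
  fixes p q :: "complex \<Rightarrow> complex"
  assumes D: "open D" and contp: "continuous_on D p" and contq: "continuous_on D q"
    and locq: "locally_inj_on q D"
    and height: "\<And>z. z \<in> D \<Longrightarrow> Im (p z) = Im (q z)"
    and sc: "simply_connected (q ` D)"
    and injp: "inj_on p D" and union: "union_of_two_real_convex_domains (p ` D)"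
  shows "inj_on q D \<and> union_of_two_real_convex_domains (q ` D)"
proof -
  obtain k where k: "homeomorphism D (p ` D) p k"
    using invariance_of_domain_homeomorphism[OF D contp _ injp] by auto
  have kp: "k (p z) = z" if "z \<in> D" for z
    using homeomorphism_apply1[OF k that] .
  have contk: "continuous_on (p ` D) k"
    using homeomorphism_cont2[OF k] .
  let ?G = "q \<circ> k"
  have im: "?G ` p ` D = q ` D"
    using kp by (force simp: image_iff)
  have "inj_on ?G (p ` D) \<and> union_of_two_real_convex_domains (?G ` p ` D)"
  proof (rule union_of_two_real_convex_domains_image[OF union])
    show "continuous_on (p ` D) ?G"
      using contk contq homeomorphism_image2[OF k] by (intro continuous_on_compose) auto
    show "locally_inj_on ?G (p ` D)"
      unfolding locally_inj_on_def
    proof clarify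
      fix z assume z: "z \<in> D"
      obtain U where U: "open U" "z \<in> U" "inj_on q (U \<inter> D)"
        using locq z unfolding locally_inj_on_def by blast
      \<comment> \<open>Since \<open>p\<close> is open, it carries a neighbourhood on which
        \<open>q\<close> is injective to one on which \<open>?G\<close> is injective.\<close>
      have "open (p ` (U \<inter> D))"
        using contp injp U(1) D
        by (meson continuous_on_subset inf_le2 inj_on_subset invariance_of_domain open_Int)
      moreover have "inj_on ?G (p ` (U \<inter> D) \<inter> p ` D)"
        using U(3) kp by (intro inj_onI) (auto, metis IntI inj_onD)
      ultimately show "\<exists>V. open V \<and> p z \<in> V \<and> inj_on ?G (V \<inter> p ` D)"
        using U(2) z by blast
    qed
    show "Im (?G w) = Im w" if "w \<in> p ` D" for w
      using that height kp by auto
    show "simply_connected (?G ` p ` D)"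
      using sc im by simp
  qed
  moreover have "inj_on q D" if "inj_on ?G (p ` D)"
    using comp_inj_on[OF injp that] kp inj_on_cong[of D "?G \<circ> p" q] by simp
  ultimately show ?thesis
    using im by simp
qed

section \<open>Local injectivity from a positive Jacobian\<close>

text \<open>Near \<open>a\<close> the increments of \<open>h\<close> and \<open>g\<close> are those
  of their linear parts up to a small multiple of \<open>cmod (z - w)\<close>, so the strict
  inequality between the derivatives passes to the increments.\<close>

lemma local_increment_bound:
  assumes S: "open S" "a \<in> S" and h: "h analytic_on S" and g: "g analytic_on S"
    and less: "cmod (deriv g a) < cmod (deriv h a)"
  obtains e where "e > 0" "ball a e \<subseteq> S"
    "\<And>z w. z \<in> ball a e \<Longrightarrow> w \<in> ball a e \<Longrightarrow> z \<noteq> w \<Longrightarrow> cmod (g z - g w) < cmod (h z - h w)"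
proof -
  \<comment> \<open>A third of the gap: the errors for \<open>h\<close> and \<open>g\<close> use up
    two thirds, and the inequality stays strict.\<close>
  define \<epsilon> where "\<epsilon> = (cmod (deriv h a) - cmod (deriv g a)) / 3"
  have \<epsilon>: "\<epsilon> > 0" "cmod (deriv g a) + \<epsilon> < cmod (deriv h a) - \<epsilon>"
    using less by (auto simp: \<epsilon>_def field_simps)
  have approx: "\<exists>e>0. ball a e \<subseteq> S \<and>
      (\<forall>z\<in>ball a e. \<forall>w\<in>ball a e. cmod (k z - k w - deriv k a * (z - w)) \<le> \<epsilon> * cmod (z - w))"
    if k: "k analytic_on S" for k
  proof -
    have "continuous_on S (deriv k)"
      using k analytic_deriv analytic_imp_holomorphic holomorphic_on_imp_continuous_on by blast
    then have "continuous (at a) (deriv k)"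
      using S continuous_on_eq_continuous_at by blast
    then obtain d where d: "d > 0" "\<And>z. dist z a < d \<Longrightarrow> dist (deriv k z) (deriv k a) < \<epsilon>"
      using \<epsilon>(1) unfolding continuous_at_eps_delta by blast
    obtain d' where d': "d' > 0" "ball a d' \<subseteq> S"
      using S open_contains_ball by blast
    define e where "e = min d d'"
    have e: "e > 0" "ball a e \<subseteq> S" "ball a e \<subseteq> ball a d"
      using d(1) d' by (auto simp: e_def)
    \<comment> \<open>With the linear part subtracted, the derivative is at most
      \<open>\<epsilon>\<close> on the convex ball, so the mean value inequality applies.\<close>
    have "cmod ((k z - deriv k a * z) - (k w - deriv k a * w)) \<le> \<epsilon> * cmod (z - w)"
      if zw: "z \<in> ball a e" "w \<in> ball a e" for z w
    proof (rule field_differentiable_bound[OF convex_ball _ _ zw])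
      fix x assume x: "x \<in> ball a e"
      then have "k analytic_on {x}"
        using k e(2) analytic_on_subset by blast
      then show "((\<lambda>z. k z - deriv k a * z) has_field_derivative (deriv k x - deriv k a))
          (at x within ball a e)"
        by (auto intro!: derivative_eq_intros analytic_derivI)
      show "cmod (deriv k x - deriv k a) \<le> \<epsilon>"
        using d(2)[of x] x e(3) by (auto simp: dist_norm norm_minus_commute subset_iff)
    qed
    then show ?thesis
      using e by (intro exI[of _ e]) (auto simp: algebra_simps)
  qed
  obtain e1 where e1: "e1 > 0" "ball a e1 \<subseteq> S"
    "\<And>z w. z \<in> ball a e1 \<Longrightarrow> w \<in> ball a e1 \<Longrightarrow>
      cmod (h z - h w - deriv h a * (z - w)) \<le> \<epsilon> * cmod (z - w)"
    using approx[OF h] by blast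
  obtain e2 where e2: "e2 > 0"
    "\<And>z w. z \<in> ball a e2 \<Longrightarrow> w \<in> ball a e2 \<Longrightarrow>
      cmod (g z - g w - deriv g a * (z - w)) \<le> \<epsilon> * cmod (z - w)"
    using approx[OF g] by blast
  show ?thesis
  proof (rule that[of "min e1 e2"])
    show "min e1 e2 > 0" "ball a (min e1 e2) \<subseteq> S"
      using e1 e2 by auto
    fix z w assume zw: "z \<in> ball a (min e1 e2)" "w \<in> ball a (min e1 e2)" "z \<noteq> w"
    have "cmod (g z - g w) \<le> cmod (deriv g a * (z - w)) + \<epsilon> * cmod (z - w)"
      using e2(2)[of z w] zw norm_triangle_sub[of "g z - g w" "deriv g a * (z - w)"] by auto
    also have "\<dots> = (cmod (deriv g a) + \<epsilon>) * cmod (z - w)"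
      by (simp add: norm_mult distrib_right)
    also have "\<dots> < (cmod (deriv h a) - \<epsilon>) * cmod (z - w)"
      using \<epsilon>(2) zw(3) by (intro mult_strict_right_mono) auto
    also have "\<dots> = cmod (deriv h a * (z - w)) - \<epsilon> * cmod (z - w)"
      by (simp add: norm_mult left_diff_distrib)
    also have "\<dots> \<le> cmod (h z - h w)"
      using e1(3)[of z w] zw norm_triangle_sub[of "deriv h a * (z - w)" "h z - h w"]
      by (auto simp: norm_minus_commute)
    finally show "cmod (g z - g w) < cmod (h z - h w)" .
  qed
qed

text \<open>The hypothesis \<open>same\<close> holds for \<open>h - g\<close> as well as for
  \<open>h + cnj g\<close>: equal values make the increments of \<open>h\<close> and
  \<open>g\<close> agree up to sign and conjugation. It contradicts the strict increment bound at
  distinct nearby points.\<close>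

lemma locally_inj_on_of_jacobian_pos:
  assumes S: "open S" and h: "h analytic_on S" and g: "g analytic_on S"
    and jac: "\<And>z. z \<in> S \<Longrightarrow> harmonic_jacobian h g z > 0"
    and same: "\<And>z w. z \<in> S \<Longrightarrow> w \<in> S \<Longrightarrow> k z = k w \<Longrightarrow> cmod (h z - h w) = cmod (g z - g w)"
  shows "locally_inj_on k S"
  unfolding locally_inj_on_def
proof
  fix a assume a: "a \<in> S"
  have "cmod (deriv g a) < cmod (deriv h a)"
    using jac[OF a] by (auto simp: harmonic_jacobian_def intro: power2_less_imp_less)
  then obtain e where e: "e > 0" "ball a e \<subseteq> S"
    "\<And>z w. z \<in> ball a e \<Longrightarrow> w \<in> ball a e \<Longrightarrow> z \<noteq> w \<Longrightarrow> cmod (g z - g w) < cmod (h z - h w)"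
    using local_increment_bound[OF S a h g] by blast
  have "inj_on k (ball a e \<inter> S)"
    using e(3) same by (intro inj_onI) (metis IntE less_irrefl)
  then show "\<exists>U. open U \<and> a \<in> U \<and> inj_on k (U \<inter> S)"
    using e(1) by (intro exI[of _ "ball a e"]) auto
qed

theorem theorem3p3:
  fixes f h g :: "complex \<Rightarrow> complex"
  assumes "complex_harmonic_on f (ball 0 1)"
    and "h analytic_on ball 0 1" and "g analytic_on ball 0 1"
    and "\<And>z. z \<in> ball 0 1 \<Longrightarrow> f z = h z + cnj (g z)"
    and "\<And>z. z \<in> ball 0 1 \<Longrightarrow> harmonic_jacobian h g z > 0"
    and "planar_domain ((\<lambda>z. h z - g z) ` ball 0 1)"
    and "simply_connected ((\<lambda>z. h z - g z) ` ball 0 1)"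
    and "planar_domain (f ` ball 0 1)"
    and "simply_connected (f ` ball 0 1)"
  shows "(inj_on f (ball 0 1) \<and> union_of_two_real_convex_domains (f ` ball 0 1))
     \<longleftrightarrow>
         (inj_on (\<lambda>z. h z - g z) (ball 0 1) \<and> (\<lambda>z. h z - g z) analytic_on ball 0 1 \<and>
          union_of_two_real_convex_domains ((\<lambda>z. h z - g z) ` ball 0 1))"
proof -
  let ?D = "ball (0::complex) 1" and ?\<phi> = "\<lambda>z. h z - g z"
  have an: "?\<phi> analytic_on ?D"
    using assms(2,3) by (rule analytic_on_diff)
  have conth: "continuous_on ?D h" and contg: "continuous_on ?D g"
    using assms(2,3) analytic_imp_holomorphic holomorphic_on_imp_continuous_on by blast+
  then have cont\<phi>: "continuous_on ?D ?\<phi>"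
    by (rule continuous_on_diff)
  have "continuous_on ?D (\<lambda>z. h z + cnj (g z))"
    by (intro continuous_intros conth contg)
  then have contf: "continuous_on ?D f"
    by (rule continuous_on_eq) (simp add: assms(4))
  have loc\<phi>: "locally_inj_on ?\<phi> ?D"
  proof (rule locally_inj_on_of_jacobian_pos[OF open_ball assms(2,3,5)])
    fix z w assume "h z - g z = h w - g w"
    then have "h z - h w = g z - g w"
      by (simp add: algebra_simps)
    then show "cmod (h z - h w) = cmod (g z - g w)"
      by simp
  qed
  have locf: "locally_inj_on f ?D"
  proof (rule locally_inj_on_of_jacobian_pos[OF open_ball assms(2,3,5)])
    fix z w assume "z \<in> ?D" "w \<in> ?D" "f z = f w"
    then have "h z - h w = - cnj (g z - g w)"
      using assms(4) by (simp add: algebra_simps)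
    then show "cmod (h z - h w) = cmod (g z - g w)"
      by (metis complex_mod_cnj norm_minus_cancel)
  qed
  have height: "Im (f z) = Im (?\<phi> z)" if "z \<in> ?D" for z
    using assms(4)[OF that] by simp
  show ?thesis
    \<comment> \<open>The first instance leads from \<open>f\<close> to \<open>?\<phi>\<close>, the
      second back.\<close>
    using an transfer_between_equal_heights[OF open_ball contf cont\<phi> loc\<phi> height assms(7)]
      transfer_between_equal_heights[OF open_ball cont\<phi> contf locf height[symmetric] assms(9)]
    by blast
qed

end
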